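(* Let $\beta$ be the tribonacci number, i.e. the unique root in $(1,2)$ of $x^3=x^2+x+1$. For every integer $m\ge 0$, $$S_\beta(3m+2)=\frac{1+\beta-\beta^{3m+1}-\beta^{3m+3}}{(1-\beta^3)(\beta^{3m+2}-1)}.$$ Moreover, along the periods $p=3m+2$, $m\ge0$, the value $S_\beta(p)$ is increasing in $p$ and converges to $\frac{\beta^2+1}{\beta^4-\beta}$ as $p\to\infty$.
   Context: For $\beta\in(1,2]$ let $T_\beta:[0,1)\to[0,1)$, $T_\beta(x)=\beta x \pmod 1$. For $t\in[0,1)$ the survivor set is $K_\beta(t)=\{x\in[0,1): T_\beta^n(x)\ge t \text{ for all } n\ge 0\}$. A point $x$ has smallest period $p$ if $T_\beta^p(x)=x$ and $T_\beta^j(x)\ne x$ for all $1\le j<p$. For a positive integer $p$, $$S_\beta(p)=\sup\{t\in[0,1): K_\beta(t)\text{ contains a point of smallest period } p\}.$$ *)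

theory Defs
  imports Complex_Main
begin

definition beta_map :: "real \<Rightarrow> real \<Rightarrow> real" where
  "beta_map \<beta> x = frac (\<beta> * x)"

definition survivor_set :: "real \<Rightarrow> real \<Rightarrow> real set" where
  "survivor_set \<beta> t = {x \<in> {0..<1}. \<forall>n. (beta_map \<beta> ^^ n) x \<ge> t}"

definition has_smallest_period :: "real \<Rightarrow> nat \<Rightarrow> real \<Rightarrow> bool" where
  "has_smallest_period \<beta> p x \<longleftrightarrow>
     0 < p \<and> (beta_map \<beta> ^^ p) x = x \<and> (\<forall>j\<in>{1..<p}. (beta_map \<beta> ^^ j) x \<noteq> x)"

definition S :: "real \<Rightarrow> nat \<Rightarrow> real" where
  "S \<beta> p = Sup {t \<in> {0..<1}. \<exists>x\<in>survivor_set \<beta> t. has_smallest_period \<beta> p x}"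

definition tribonacci :: real where
  "tribonacci = (THE x. 1 < x \<and> x < 2 \<and> x^3 = x^2 + x + 1)"

lemma tribonacci_ex1: "\<exists>!x::real. 1 < x \<and> x < 2 \<and> x^3 = x^2 + x + 1"
proof (rule ex_ex1I)
  have "\<exists>x\<ge>1. x \<le> 2 \<and> x^3 - x^2 - x - (1::real) = 0"
    by (rule IVT) (auto intro!: continuous_intros)
  then obtain x :: real where x: "1 \<le> x" "x \<le> 2" "x^3 - x^2 - x - 1 = 0"
    by blast
  moreover have "x \<noteq> 1" "x \<noteq> 2"
    using x(3) by auto
  ultimately have "1 < x \<and> x < 2 \<and> x^3 = x^2 + x + 1"
    by (auto simp: less_le)
  then show "\<exists>x::real. 1 < x \<and> x < 2 \<and> x^3 = x^2 + x + 1"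
    by blast
next
  fix x y :: real
  assume x: "1 < x \<and> x < 2 \<and> x^3 = x^2 + x + 1"
    and y: "1 < y \<and> y < 2 \<and> y^3 = y^2 + y + 1"
  have "(x - y) * (x * (x - 1) + y * (y - 1) + (x * y - 1)) = 0"
    using x y by (simp add: algebra_simps power2_eq_square power3_eq_cube)
  moreover have "x * (x - 1) + y * (y - 1) + (x * y - 1) > 0"
    using x y less_1_mult[of x y] by (intro add_pos_pos mult_pos_pos) auto
  ultimately show "x = y"
    by auto
qed

lemma tribonacci: "1 < tribonacci" "tribonacci < 2"
  "tribonacci^3 = tribonacci^2 + tribonacci + 1"
  using theI'[OF tribonacci_ex1] by (simp_all add: tribonacci_def)

end

theory Submission
  imports Defs
begin

text \<open>
  Write \<open>T\<close> for the map \<open>x \<mapsto> \<beta> x mod 1\<close>.  A cyclic word of length \<open>3m+2\<close> over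
  \<open>0, 1\<close> is the digit sequence of a periodic point if and only if it has no factor \<open>111\<close>.  Among
  these words, the one whose smallest rotation is largest is \<open>01(011)\<^sup>m\<close>.  Indeed, a word with a
  factor \<open>00\<close> has a rotation starting with \<open>00\<close>.  Any other word is a product of blocks \<open>01\<close> and
  \<open>011\<close>, and the length forces the number of blocks \<open>01\<close> to be \<open>1\<close> modulo \<open>3\<close>; if there is
  more than one, some rotation starts with \<open>01(011)\<^sup>j01\<close> for some \<open>j < m\<close> and is smaller.

  The proof replaces words by the first return map to \<open>[0, 1/\<beta>)\<close>.  Near \<open>1/\<beta>\<close>, points are
  written as \<open>1/\<beta> - s/\<beta>\<^sup>4\<close>; the equation \<open>\<beta>\<^sup>3 = \<beta>\<^sup>2 + \<beta> + 1\<close> makes both branches of the return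
  map simple in the coordinate \<open>s\<close>:
    \<^item> for \<open>0 < s \<le> 1\<close> (block \<open>011\<close>), the return takes three steps and is \<open>s \<mapsto> \<beta>\<^sup>3 s\<close>;
    \<^item> for \<open>1 < s \<le> \<beta> + 1\<close> (block \<open>01\<close>), it takes two steps and is \<open>s \<mapsto> \<beta>\<^sup>2 (s - 1)\<close>.

  Let \<open>y\<close> be the least point of a periodic orbit, with coordinate \<open>s\<close>.  Then \<open>y < 1/\<beta>\<close>, and
  \<open>s \<le> 1\<close> is impossible since the long branch would lead to a smaller point.  So \<open>s = 1 + e\<close>
  with \<open>e > 0\<close>.  If \<open>e (\<beta>\<^sup>p - 1) \<le> 1\<close> with \<open>p = 3m+2\<close>, one short return and \<open>m\<close> long returns
  follow, and \<open>T\<^sup>p y\<close> has coordinate \<open>\<beta>\<^sup>p e\<close>.  Hence \<open>T\<^sup>p y = y\<close> forces \<open>e = 1/(\<beta>\<^sup>p - 1)\<close>, so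
  no least point of an orbit of period \<open>p\<close> lies above the one with this value of \<open>e\<close>.
  Conversely the point with this \<open>e\<close> has period \<open>p\<close>, and the rest of its orbit lies strictly
  above it, so \<open>p\<close> is its smallest period.  Thus the threshold is
  \<open>1/\<beta> - (1 + 1/(\<beta>\<^sup>p - 1))/\<beta>\<^sup>4\<close>, from which the closed form, the monotonicity and the limit
  are read off.
\<close>

section \<open>The map and its two branches\<close>

locale tribonacci_base =
  fixes \<beta> :: real
  assumes gt_1: "1 < \<beta>" and lt_2: "\<beta> < 2" and cubic: "\<beta>^3 = \<beta>^2 + \<beta> + 1"
begin

abbreviation T :: "real \<Rightarrow> real" where
  "T \<equiv> beta_map \<beta>"

text \<open>
  The factor \<open>\<beta>\<^sup>4\<close> puts the boundary between the two branches of the return map at \<open>s = 1\<close>.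
  The map \<open>pt\<close> reverses the order.
\<close>
definition pt :: "real \<Rightarrow> real" where
  "pt s = 1/\<beta> - s/\<beta>^4"

definition extremal :: "nat \<Rightarrow> real" where
  "extremal m = pt (1 + 1/(\<beta>^(3*m+2) - 1))"

lemma pt_less_iff [simp]: "pt a < pt b \<longleftrightarrow> b < a"
  using gt_1 by (simp add: pt_def divide_less_cancel)

lemma pt_le_iff [simp]: "pt a \<le> pt b \<longleftrightarrow> b \<le> a"
  using gt_1 by (simp add: pt_def divide_le_cancel)

lemma pt_eq_iff [simp]: "pt a = pt b \<longleftrightarrow> a = b"
  using gt_1 by (simp add: pt_def)

lemma pt_0: "pt 0 = 1/\<beta>"
  by (simp add: pt_def)

lemma pt_surj: obtains s where "y = pt s"
proof
  show "y = pt (\<beta>^4 * (1/\<beta> - y))"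
    using gt_1 by (simp add: pt_def)
qed

lemma quartic: "\<beta>^4 = \<beta>^3 + \<beta>^2 + \<beta>"
proof -
  have "\<beta>^4 = \<beta> * \<beta>^3"
    by (simp add: eval_nat_numeral)
  also have "\<dots> = \<beta> * (\<beta>^2 + \<beta> + 1)"
    by (simp only: cubic)
  finally show ?thesis
    by (simp add: algebra_simps power2_eq_square power3_eq_cube)
qed

lemma low_branch: "0 \<le> x \<Longrightarrow> x < 1/\<beta> \<Longrightarrow> T x = \<beta> * x"
  using gt_1 by (simp add: beta_map_def frac_eq field_simps)

lemma high_branch: "1/\<beta> \<le> x \<Longrightarrow> x < 1 \<Longrightarrow> T x = \<beta> * x - 1"
proof -
  assume "1/\<beta> \<le> x" "x < 1"
  then have "1 \<le> \<beta> * x" "\<beta> * x < \<beta> * 1"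
    using gt_1 by (simp_all add: field_simps)
  then have "\<lfloor>\<beta> * x\<rfloor> = 1"
    using lt_2 by linarith
  then show "T x = \<beta> * x - 1"
    by (simp add: beta_map_def frac_def)
qed

lemma T_range: "T x \<in> {0..<1}"
  by (simp add: beta_map_def frac_ge_0 frac_lt_1)

lemma orbit_range: "x \<in> {0..<1} \<Longrightarrow> (T ^^ n) x \<in> {0..<1}"
  by (cases n) (use T_range in auto)

section \<open>The return map in the coordinate s\<close>

lemma pt_nonneg: "s \<le> \<beta> + 1 \<Longrightarrow> 0 \<le> pt s"
proof -
  assume "s \<le> \<beta> + 1"
  moreover have "\<beta> + 1 \<le> \<beta>^3"
    using cubic by simp
  ultimately have "s/\<beta>^4 \<le> \<beta>^3/\<beta>^4"
    using gt_1 by (intro divide_right_mono) auto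
  also have "\<dots> = 1/\<beta>"
    using gt_1 by (simp add: field_simps eval_nat_numeral)
  finally show ?thesis
    by (simp add: pt_def)
qed

lemma T_pt:
  assumes "0 < s" "s \<le> \<beta> + 1"
  shows "T (pt s) = 1 - s/\<beta>^3"
proof -
  have "pt s < 1/\<beta>"
    using assms pt_0 pt_less_iff[of s 0] by simp
  then have "T (pt s) = \<beta> * pt s"
    using low_branch pt_nonneg assms by blast
  also have "\<dots> = 1 - s/\<beta>^3"
    using gt_1 by (simp add: pt_def field_simps eval_nat_numeral)
  finally show ?thesis .
qed

lemma T_pt_ge:
  assumes "0 < s" "s \<le> \<beta> + 1"
  shows "1/\<beta> \<le> T (pt s)"
proof -
  have "s/\<beta>^3 \<le> (\<beta> + 1)/\<beta>^3"
    using gt_1 assms by (intro divide_right_mono) auto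
  also have "\<dots> = 1 - \<beta>^2/\<beta>^3"
  proof -
    have "\<beta> + 1 = \<beta>^3 - \<beta>^2"
      using cubic by simp
    then show ?thesis
      using gt_1 by (simp add: diff_divide_distrib)
  qed
  also have "\<dots> = 1 - 1/\<beta>"
    using gt_1 by (simp add: field_simps eval_nat_numeral)
  finally show ?thesis
    using assms by (simp add: T_pt)
qed

text \<open>
  This formula holds on both branches.  For \<open>s \<le> 1\<close> its value is still at least \<open>1/\<beta>\<close>, so
  that the return to \<open>[0, 1/\<beta>)\<close> takes one more step.
\<close>
lemma short_return:
  assumes "0 < s" "s \<le> \<beta> + 1"
  shows "T (T (pt s)) = pt (\<beta>^2 * (s - 1))"
proof -
  have "T (T (pt s)) = \<beta> * (1 - s/\<beta>^3) - 1"
    using high_branch[OF T_pt_ge] assms T_range[of "pt s"] by (simp add: T_pt)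
  also have "\<dots> = pt (\<beta>^2 * (s - 1))"
  proof -
    have "\<beta>^4 * (\<beta> - 1) = \<beta>^3 + \<beta>^2"
    proof -
      have "\<beta>^4 * (\<beta> - 1) = \<beta> * \<beta>^4 - \<beta>^4"
        by (simp add: algebra_simps)
      also have "\<dots> = \<beta>^3 + \<beta>^2"
        by (subst (1) quartic) (simp add: quartic cubic algebra_simps eval_nat_numeral)
      finally show ?thesis .
    qed
    then have "\<beta> - 1 = (\<beta>^3 + \<beta>^2)/\<beta>^4"
      using gt_1 by (simp add: eq_divide_eq mult_ac)
    also have "\<dots> = 1/\<beta> + \<beta>^2/\<beta>^4"
      using gt_1 by (simp add: field_simps eval_nat_numeral)
    finally have "\<beta> * (1 - s/\<beta>^3) - 1 = 1/\<beta> + \<beta>^2/\<beta>^4 - \<beta> * (s/\<beta>^3)"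
      by (simp add: algebra_simps)
    also have "\<beta> * (s/\<beta>^3) = \<beta>^2 * s/\<beta>^4"
      using gt_1 by (simp add: field_simps eval_nat_numeral)
    finally show ?thesis
      by (simp add: pt_def algebra_simps diff_divide_distrib)
  qed
  finally show ?thesis .
qed

lemma long_return:
  assumes "0 < s" "s \<le> 1"
  shows "T (T (T (pt s))) = pt (\<beta>^3 * s)"
proof -
  have s: "s \<le> \<beta> + 1"
    using assms gt_1 by simp
  have "\<beta>^2 * (s - 1) \<le> 0"
    using assms by (simp add: mult_nonneg_nonpos)
  then have "1/\<beta> \<le> pt (\<beta>^2 * (s - 1))"
    by (simp flip: pt_0)
  moreover have "pt (\<beta>^2 * (s - 1)) < 1"
    using short_return[OF assms(1) s] T_range[of "T (pt s)"] by simp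
  ultimately have "T (T (T (pt s))) = \<beta> * pt (\<beta>^2 * (s - 1)) - 1"
    using short_return[OF assms(1) s] high_branch by simp
  also have "\<dots> = pt (\<beta>^3 * s)"
  proof -
    have "\<beta> * (\<beta>^2/\<beta>^4) = 1/\<beta>"
      using gt_1 by (simp add: field_simps eval_nat_numeral)
    then show ?thesis
      using gt_1 by (simp add: pt_def algebra_simps diff_divide_distrib)
        (simp add: field_simps eval_nat_numeral)
  qed
  finally show ?thesis .
qed

text \<open>
  The bound is \<open>\<beta>\<^sup>3\<close> and not \<open>1\<close> because only the coordinates before the last return
  have to stay on the long branch.
\<close>
lemma long_returns:
  assumes "0 < s" "\<beta>^(3*j) * s \<le> \<beta>^3"
  shows "(T ^^ (3*j)) (pt s) = pt (\<beta>^(3*j) * s)"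
  using assms(2)
proof (induction j)
  case 0
  then show ?case by simp
next
  case (Suc j)
  let ?r = "\<beta>^(3*j) * s"
  have "\<beta>^3 * ?r \<le> \<beta>^3 * 1"
    using Suc.prems by (simp add: power_add mult_ac)
  then have r1: "?r \<le> 1"
    using gt_1 by (subst (asm) mult_le_cancel_left_pos) auto
  moreover have "1 \<le> \<beta>^3"
    using gt_1 by simp
  ultimately have "(T ^^ (3*j)) (pt s) = pt ?r"
    using Suc.IH by linarith
  moreover have "T (T (T (pt ?r))) = pt (\<beta>^3 * ?r)"
    using r1 assms(1) gt_1 by (intro long_return) auto
  moreover have "3 * Suc j = 3 + 3*j"
    by simp
  then have "(T ^^ (3 * Suc j)) (pt s) = T (T (T ((T ^^ (3*j)) (pt s))))"
    by (simp only: funpow_add o_apply) (simp add: eval_nat_numeral)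
  ultimately show ?case
    by (simp add: power_add mult_ac)
qed

section \<open>The extremal orbit\<close>

lemma power_gap: "\<beta>^(n+2) + 1 \<le> \<beta>^(n+5)"
proof -
  have "1 \<le> \<beta>^(n+2)"
    using gt_1 by (intro one_le_power) auto
  moreover have "1 \<le> \<beta>^3 - 1"
    using gt_1 cubic zero_le_power2[of \<beta>] by linarith
  ultimately have "1 * 1 \<le> \<beta>^(n+2) * (\<beta>^3 - 1)"
    by (intro mult_mono) auto
  also have "\<dots> = \<beta>^(n+5) - \<beta>^(n+2)"
    by (simp add: power_add algebra_simps eval_nat_numeral)
  finally show ?thesis
    by simp
qed

lemma period_power_gt_1: "1 < \<beta>^(3*m+2)"
  using gt_1 by (intro one_less_power) auto

text \<open>
  Points with coordinate \<open>1 + e\<close> between the extremal point and the branch boundary share the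
  itinerary of the extremal point: the coordinate \<open>\<beta>\<^sup>2 e\<close> after the short return grows by the
  factor \<open>\<beta>\<^sup>3\<close>, but stays on the long branch for \<open>m\<close> returns because
  \<open>\<beta>\<^sup>n\<^sup>-\<^sup>3 \<le> \<beta>\<^sup>n - 1\<close> for \<open>n \<ge> 5\<close>.
\<close>
lemma below_extremal:
  assumes "0 < e" "e * (\<beta>^(3*m+2) - 1) \<le> 1"
  shows "1 + e \<le> \<beta> + 1" and "j < m \<Longrightarrow> \<beta>^(3*j) * (\<beta>^2 * e) \<le> 1"
    and "\<beta>^(3*m) * (\<beta>^2 * e) \<le> \<beta>^3"
proof -
  have "1 \<le> \<beta> * (\<beta>^2 - 1)"
    using cubic gt_1 by (simp add: algebra_simps power2_eq_square power3_eq_cube)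
  also have "\<dots> \<le> \<beta> * (\<beta>^(3*m+2) - 1)"
    using gt_1 by (intro mult_left_mono diff_right_mono power_increasing) auto
  finally have "e * (\<beta>^(3*m+2) - 1) \<le> \<beta> * (\<beta>^(3*m+2) - 1)"
    using assms by linarith
  then show e: "1 + e \<le> \<beta> + 1"
    using period_power_gt_1[of m] by simp
  show *: "\<beta>^(3*j) * (\<beta>^2 * e) \<le> 1" if "j < m" for j
  proof -
    have "\<beta>^(3*j+2) + 1 \<le> \<beta>^(3*j+5)"
      by (rule power_gap)
    also have "\<dots> \<le> \<beta>^(3*m+2)"
      using that gt_1 by (intro power_increasing) auto
    finally have "e * \<beta>^(3*j+2) \<le> e * (\<beta>^(3*m+2) - 1)"
      using assms(1) by (intro mult_left_mono) auto
    then show ?thesis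
      using assms(2) by (simp add: power_add mult_ac del: add_2_eq_Suc')
  qed
  show "\<beta>^(3*m) * (\<beta>^2 * e) \<le> \<beta>^3"
  proof (cases m)
    case 0
    have "\<beta>^2 * e \<le> \<beta>^2 * \<beta>"
      using e by (intro mult_left_mono) auto
    then show ?thesis
      using 0 by (simp add: eval_nat_numeral)
  next
    case (Suc k)
    have "\<beta>^3 * (\<beta>^(3*k) * (\<beta>^2 * e)) \<le> \<beta>^3 * 1"
      using *[of k] Suc gt_1 by (intro mult_left_mono) auto
    then show ?thesis
      using Suc by (simp add: power_add mult_ac)
  qed
qed

lemma short_then_long:
  assumes "0 < e" "e * (\<beta>^(3*m+2) - 1) \<le> 1" "j \<le> m"
  shows "(T ^^ (3*j+2)) (pt (1 + e)) = pt (\<beta>^(3*j+2) * e)"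
proof -
  have "\<beta>^(3*j) * (\<beta>^2 * e) \<le> \<beta>^3"
  proof (cases "j = m")
    case True
    then show ?thesis
      using below_extremal(3)[OF assms(1,2)] by simp
  next
    case False
    moreover have "1 \<le> \<beta>^3"
      using gt_1 by simp
    ultimately show ?thesis
      using below_extremal(2)[OF assms(1,2), of j] assms(3) by linarith
  qed
  then have "(T ^^ (3*j)) (pt (\<beta>^2 * e)) = pt (\<beta>^(3*j) * (\<beta>^2 * e))"
    using assms(1) gt_1 by (intro long_returns) auto
  moreover have "(T ^^ 2) (pt (1 + e)) = pt (\<beta>^2 * e)"
    using short_return[OF _ below_extremal(1)[OF assms(1,2)]] assms(1)
    by (simp add: eval_nat_numeral)
  ultimately show ?thesis
    by (simp only: funpow_add o_apply power_add mult.assoc)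
qed

text \<open>
  Blocks \<open>011\<close> do not bring the orbit below the branch boundary before the next return.
\<close>
lemma long_branch_stays_high:
  assumes "0 < s" "s \<le> 1" "i < 3"
  shows "pt 1 \<le> (T ^^ i) (pt s)"
proof -
  have s: "s \<le> \<beta> + 1"
    using assms gt_1 by simp
  have "pt 1 \<le> 1/\<beta>"
    by (simp flip: pt_0)
  then have "pt 1 \<le> T (pt s)"
    using T_pt_ge[OF assms(1) s] by linarith
  moreover have "\<beta>^2 * (s - 1) \<le> 0"
    using assms by (simp add: mult_nonneg_nonpos)
  then have "pt 1 \<le> T (T (pt s))"
    using short_return[OF assms(1) s] by simp
  moreover have "i = 0 \<or> i = 1 \<or> i = 2"
    using assms(3) by auto
  ultimately show ?thesis
    using assms(2) by (auto simp: numeral_2_eq_2)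
qed

lemma extremal_periodic: "(T ^^ (3*m+2)) (extremal m) = extremal m"
proof -
  let ?e = "1/(\<beta>^(3*m+2) - 1)"
  have e: "0 < ?e" "?e * (\<beta>^(3*m+2) - 1) \<le> 1"
    using period_power_gt_1[of m] by auto
  have "\<beta>^(3*m+2) * ?e = 1 + ?e"
    using period_power_gt_1[of m] by (simp add: field_simps)
  then show ?thesis
    using short_then_long[OF e order.refl] by (simp add: extremal_def)
qed

text \<open>
  In word terms: every proper rotation of \<open>01(011)\<^sup>m\<close> is strictly larger than \<open>01(011)\<^sup>m\<close>.
\<close>
lemma extremal_less_orbit:
  assumes "0 < n" "n < 3*m+2"
  shows "extremal m < (T ^^ n) (extremal m)"
proof -
  let ?e = "1/(\<beta>^(3*m+2) - 1)"
  have e: "0 < ?e" "?e * (\<beta>^(3*m+2) - 1) \<le> 1"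
    using period_power_gt_1[of m] by auto
  have ext1: "extremal m < pt 1"
    using e(1) by (simp add: extremal_def)
  show ?thesis
  proof (cases "n = 1")
    case True
    have "pt 1 < 1/\<beta>"
      by (simp flip: pt_0)
    also have "\<dots> \<le> T (extremal m)"
      unfolding extremal_def using below_extremal(1)[OF e] add_pos_pos[OF zero_less_one e(1)]
      by (rule T_pt_ge[rotated])
    finally show ?thesis
      using ext1 True by simp
  next
    case False
    define j i where "j = (n - 2) div 3" and "i = (n - 2) mod 3"
    have n: "n = i + (3*j + 2)" and ji: "j < m" "i < 3"
      using assms False by (auto simp: j_def i_def)
    have "(T ^^ n) (extremal m) = (T ^^ i) (pt (\<beta>^(3*j+2) * ?e))"
      using short_then_long[OF e, of j] ji
      by (simp only: n funpow_add[of i] o_apply extremal_def less_imp_le)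
    moreover have "pt 1 \<le> (T ^^ i) (pt (\<beta>^(3*j+2) * ?e))"
      using below_extremal(2)[OF e ji(1)] e(1) gt_1 ji(2)
      by (intro long_branch_stays_high) (auto simp: power_add mult_ac simp del: add_2_eq_Suc')
    ultimately show ?thesis
      using ext1 by simp
  qed
qed

lemma extremal_in_unit: "extremal m \<in> {0..<1}"
  using orbit_range T_range[of "(T ^^ (3*m+1)) (extremal m)"] extremal_periodic[of m]
  by simp

lemma extremal_smallest_period: "has_smallest_period \<beta> (3*m+2) (extremal m)"
  unfolding has_smallest_period_def
proof (intro conjI ballI)
  show "(T ^^ j) (extremal m) \<noteq> extremal m" if "j \<in> {1..<3*m+2}" for j
    using extremal_less_orbit[of j m] that by (simp add: Suc_le_eq less_imp_neq)
qed (simp, rule extremal_periodic)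

lemma extremal_survives: "extremal m \<in> survivor_set \<beta> (extremal m)"
proof -
  have "extremal m \<le> (T ^^ n) (extremal m)" for n
  proof -
    have "(T ^^ n) (extremal m) = (T ^^ (n mod (3*m+2))) (extremal m)"
      using funpow_mod_eq[OF extremal_periodic[of m]] by simp
    then show ?thesis
      using extremal_less_orbit[of "n mod (3*m+2)" m]
      by (cases "n mod (3*m+2) = 0") (auto intro: less_imp_le)
  qed
  then show ?thesis
    using extremal_in_unit by (simp add: survivor_set_def)
qed

section \<open>Optimality\<close>

text \<open>
  A least point above the extremal one would start with one short and \<open>m\<close> long returns as
  well, and the expansion by \<open>\<beta>\<^sup>p\<close> leaves room for only one such periodic point.
\<close>
lemma least_point_le_extremal:
  assumes y: "y \<in> {0..<1}" and least: "\<And>n. y \<le> (T ^^ n) y"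
    and per: "(T ^^ (3*m+2)) y = y"
  shows "y \<le> extremal m"
proof (rule ccontr)
  assume "\<not> y \<le> extremal m"
  obtain s where s: "y = pt s"
    by (rule pt_surj)
  \<comment> \<open>On \<open>[1/\<beta>, 1)\<close> the map lies below the diagonal, as its fixed point there would be \<open>1/(\<beta>-1) > 1\<close>.\<close>
  have "y < 1/\<beta>"
  proof (rule ccontr)
    assume "\<not> y < 1/\<beta>"
    then have "y \<le> \<beta> * y - 1"
      using y high_branch[of y] least[of 1] by simp
    moreover have "(\<beta> - 1) * y < 1"
      using y gt_1 lt_2 mult_mono[of "\<beta> - 1" 1 y y] by simp
    ultimately show False
      by (simp add: algebra_simps)
  qed
  then have s0: "0 < s"
    using s by (simp flip: pt_0)
  \<comment> \<open>On the long branch \<open>T\<^sup>3\<close> moves points away from \<open>1/\<beta>\<close>, hence downwards.\<close>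
  have s1: "1 < s"
  proof (rule ccontr)
    assume "\<not> 1 < s"
    then have "(T ^^ 3) y = pt (\<beta>^3 * s)"
      using s s0 long_return[of s] by (simp add: eval_nat_numeral)
    moreover have "1 * s < \<beta>^3 * s"
      using s0 gt_1 by (intro mult_strict_right_mono one_less_power) auto
    ultimately show False
      using least[of 3] s by simp
  qed
  define e where "e = s - 1"
  have e: "0 < e" "e < 1/(\<beta>^(3*m+2) - 1)"
    using s1 s \<open>\<not> y \<le> extremal m\<close> by (auto simp: e_def extremal_def)
  then have e': "e * (\<beta>^(3*m+2) - 1) < 1"
    using period_power_gt_1[of m] by (simp add: pos_less_divide_eq)
  have "pt (\<beta>^(3*m+2) * e) = pt (1 + e)"
    using short_then_long[OF e(1) less_imp_le[OF e'] order.refl] per s by (simp add: e_def)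
  then show False
    using e' by (simp add: algebra_simps)
qed

text \<open>
  A periodic orbit is finite, so the previous lemma applies to its least point.
\<close>
lemma survivor_threshold_le_extremal:
  assumes x: "x \<in> survivor_set \<beta> t" and p: "has_smallest_period \<beta> (3*m+2) x"
  shows "t \<le> extremal m"
proof -
  define p where "p = 3*m+2"
  have per: "(T ^^ p) x = x"
    using p by (simp add: has_smallest_period_def p_def)
  define A where "A = (\<lambda>n. (T ^^ n) x) ` {..<p}"
  have orb: "(T ^^ n) x \<in> A" for n
  proof -
    have "(T ^^ n) x = (T ^^ (n mod p)) x"
      using funpow_mod_eq[OF per] by simp
    then show ?thesis
      by (auto simp: A_def p_def)
  qed
  have fin: "finite A" "A \<noteq> {}"
    using orb by (auto simp: A_def)
  obtain k where k: "Min A = (T ^^ k) x"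
    using Min_in[OF fin] by (auto simp: A_def)
  have shift: "(T ^^ n) (Min A) = (T ^^ (n + k)) x" for n
    by (simp add: k funpow_add)
  have "Min A \<le> extremal m"
  proof (rule least_point_le_extremal)
    show "Min A \<in> {0..<1}"
      unfolding k using x by (intro orbit_range) (simp add: survivor_set_def)
    show "Min A \<le> (T ^^ n) (Min A)" for n
      unfolding shift using fin orb by (intro Min_le) auto
    have "(T ^^ (p + k)) x = (T ^^ k) ((T ^^ p) x)"
      by (subst add.commute) (simp add: funpow_add)
    then show "(T ^^ (3*m+2)) (Min A) = Min A"
      unfolding shift using per k by (simp add: p_def)
  qed
  moreover have "t \<le> Min A"
    unfolding k using x by (simp add: survivor_set_def)
  ultimately show ?thesis
    by simp
qed

lemma S_eq_extremal: "S \<beta> (3*m+2) = extremal m"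
  unfolding S_def
  by (rule cSup_eq_maximum)
    (use extremal_in_unit extremal_survives extremal_smallest_period
      survivor_threshold_le_extremal in blast)+

section \<open>Closed form, monotonicity and limit\<close>

lemma cube_minus_1: "\<beta>^3 - 1 = \<beta> * (\<beta> + 1)"
  using cubic by (simp add: algebra_simps power2_eq_square)

lemma square_succ: "(\<beta> + 1)^2 = \<beta> * (\<beta>^2 + 1)"
  using cubic by (simp add: algebra_simps power2_eq_square power3_eq_cube)

lemma extremal_closed_form:
  "extremal m = (1 + \<beta> - \<beta>^(3*m+1) - \<beta>^(3*m+3)) / ((1 - \<beta>^3) * (\<beta>^(3*m+2) - 1))"
proof -
  define q where "q = \<beta>^(3*m)"
  have P: "1 < \<beta>^2 * q"
    using period_power_gt_1[of m]
    by (simp add: q_def power_add mult_ac del: add_2_eq_Suc')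
  have cube: "1 - \<beta>^3 = - (\<beta> * (\<beta> + 1))"
    using cube_minus_1 by simp
  \<comment> \<open>The two cubic identities above turn the numerator into a multiple of \<open>\<beta>(\<beta> + 1) = \<beta>\<^sup>3 - 1\<close>.\<close>
  have "(1 + \<beta> - \<beta> * q - \<beta>^3 * q) * \<beta>^4
      = (1 + \<beta>) * \<beta>^4 - \<beta>^4 * q * (\<beta> * (\<beta>^2 + 1))"
    by (simp add: algebra_simps eval_nat_numeral)
  also have "\<dots> = (1 + \<beta>) * \<beta>^4 - \<beta>^4 * q * (\<beta> + 1)^2"
    by (simp only: square_succ)
  also have "\<dots> = - (\<beta> * (\<beta> + 1)) * ((\<beta> * (\<beta> + 1)) * (\<beta>^2 * q) - \<beta>^3)"
    by (simp add: algebra_simps eval_nat_numeral)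
  also have "\<dots> = (1 - \<beta>^3) * (\<beta>^3 * (\<beta>^2 * q - 1) - \<beta>^2 * q)"
    by (simp only: cube cube_minus_1[symmetric]) (simp add: algebra_simps)
  finally have key: "(1 + \<beta> - \<beta> * q - \<beta>^3 * q) * \<beta>^4
      = (1 - \<beta>^3) * (\<beta>^3 * (\<beta>^2 * q - 1) - \<beta>^2 * q)" .
  have "extremal m = 1/\<beta> - (\<beta>^2 * q / (\<beta>^2 * q - 1)) / \<beta>^4"
  proof -
    have "1 + 1/(\<beta>^2 * q - 1) = \<beta>^2 * q / (\<beta>^2 * q - 1)"
      using P by (simp add: field_simps)
    moreover have "\<beta>^(3*m+2) = \<beta>^2 * q"
      by (simp only: q_def power_add mult.commute)
    ultimately show ?thesis
      by (simp only: extremal_def pt_def)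
  qed
  also have "1/\<beta> = \<beta>^3/\<beta>^4"
    using gt_1 by (simp add: field_simps eval_nat_numeral)
  also have "\<beta>^3/\<beta>^4 - (\<beta>^2 * q / (\<beta>^2 * q - 1)) / \<beta>^4
      = (\<beta>^3 * (\<beta>^2 * q - 1) - \<beta>^2 * q) / ((\<beta>^2 * q - 1) * \<beta>^4)"
    using P gt_1 by (simp add: divide_simps)
  also have "\<dots> = (1 + \<beta> - \<beta> * q - \<beta>^3 * q) / ((1 - \<beta>^3) * (\<beta>^2 * q - 1))"
  proof -
    have "(\<beta>^2 * q - 1) * \<beta>^4 \<noteq> 0" "(1 - \<beta>^3) * (\<beta>^2 * q - 1) \<noteq> 0"
      using P gt_1 cube by auto
    moreover have "(\<beta>^3 * (\<beta>^2 * q - 1) - \<beta>^2 * q) * ((1 - \<beta>^3) * (\<beta>^2 * q - 1))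
        = (1 + \<beta> - \<beta> * q - \<beta>^3 * q) * ((\<beta>^2 * q - 1) * \<beta>^4)"
      using key by algebra
    ultimately show ?thesis
      by (rule frac_eq_eq[THEN iffD2])
  qed
  finally show ?thesis
    by (simp add: q_def power_add mult_ac del: add_2_eq_Suc')
qed

lemma extremal_strict_mono: "strict_mono extremal"
proof (rule strict_monoI)
  fix m n :: nat
  assume "m < n"
  then have "\<beta>^(3*m+2) < \<beta>^(3*n+2)"
    using gt_1 by (intro power_strict_increasing) auto
  then show "extremal m < extremal n"
    using period_power_gt_1[of m] by (simp add: extremal_def frac_less2)
qed

lemma pt_1: "pt 1 = (\<beta>^2 + 1)/(\<beta>^4 - \<beta>)"
proof -
  have "pt 1 = (\<beta>^3 - 1)/\<beta>^4"
    using gt_1 by (simp add: pt_def field_simps eval_nat_numeral)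
  also have "\<dots> = (\<beta>^2 + 1)/(\<beta> * (\<beta>^3 - 1))"
  proof -
    have "(\<beta>^3 - 1) * (\<beta> * (\<beta>^3 - 1)) = \<beta>^3 * (\<beta> + 1)^2"
      by (simp only: cube_minus_1) (simp add: algebra_simps eval_nat_numeral)
    also have "\<dots> = (\<beta>^2 + 1) * \<beta>^4"
      by (simp only: square_succ) (simp add: algebra_simps eval_nat_numeral)
    finally show ?thesis
      using gt_1 cube_minus_1 by (simp add: frac_eq_eq)
  qed
  also have "\<beta> * (\<beta>^3 - 1) = \<beta>^4 - \<beta>"
    by (simp add: algebra_simps eval_nat_numeral)
  finally show ?thesis .
qed

text \<open>The limit is the boundary point between the two branches of the return map.\<close>
lemma extremal_tendsto: "extremal \<longlonglongrightarrow> pt 1"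
proof -
  have "filterlim (\<lambda>n. \<beta>^n) at_infinity sequentially"
    using gt_1 by (intro filterlim_realpow_sequentially_gt1) simp
  moreover have "filterlim (\<lambda>m::nat. 3*m+2) sequentially sequentially"
    by (rule filterlim_subseq) (simp add: strict_mono_def)
  ultimately have "filterlim (\<lambda>m. \<beta>^(3*m+2)) at_infinity sequentially"
    by (rule filterlim_compose)
  then have "filterlim (\<lambda>m. \<beta>^(3*m+2) - 1) at_infinity sequentially"
    using tendsto_add_filterlim_at_infinity'[of "\<lambda>m. \<beta>^(3*m+2)" sequentially "\<lambda>_. - 1" "- 1"]
    by simp
  then have "(\<lambda>m. 1/(\<beta>^(3*m+2) - 1)) \<longlonglongrightarrow> 0"
    by (intro tendsto_divide_0[OF tendsto_const])
  then have "(\<lambda>m. pt (1 + 1/(\<beta>^(3*m+2) - 1))) \<longlonglongrightarrow> pt (1 + 0)"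
    unfolding pt_def using gt_1 by (intro tendsto_intros) auto
  then show ?thesis
    by (simp add: extremal_def [abs_def])
qed

end

theorem corollary5p3:
  fixes \<beta> :: real
  assumes "\<beta> = tribonacci"
  shows "(\<forall>m::nat. S \<beta> (3*m+2) =
            (1 + \<beta> - \<beta>^(3*m+1) - \<beta>^(3*m+3)) / ((1 - \<beta>^3) * (\<beta>^(3*m+2) - 1)))
       \<and> strict_mono (\<lambda>m::nat. S \<beta> (3*m+2))
       \<and> (\<lambda>m::nat. S \<beta> (3*m+2)) \<longlonglongrightarrow> (\<beta>^2 + 1) / (\<beta>^4 - \<beta>)"
proof -
  interpret tribonacci_base \<beta>
    using tribonacci by unfold_locales (simp_all add: assms)
  show ?thesis
    unfolding S_eq_extremal pt_1[symmetric]
    using extremal_closed_form extremal_strict_mono extremal_tendsto by blast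
qed

end
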